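(* Let $n$ be a nonnegative integer. Then \begin{align*} \mathcal U_{12n+4} = \{&(6x+3y+1,\,3y+1),\ (3x-3y-1,\,3x+3y+1),\ (-3x-6y-2,\,3x),\\ &(-6x-3y-1,\,-3y-1),\ (-3x+3y+1,\,-3x-3y-1),\ (3x+6y+2,\,-3x)\ \mid\ (x,y)\in\mathcal C_n\}. \end{align*}
   Context: For a nonnegative integer $k$, $\mathcal U_k=\{(x,y)\in\mathbb Z^2\mid x^2+3y^2=k\}$. A $3$-core partition is an integer partition whose Young diagram has no hook of length $3$ (the hook of a box $b$ consists of $b$, the boxes to its right in its row and the boxes below it in its column; its hooklength is its number of boxes). The size $|\lambda|$ of a partition $\lambda$ is the sum of its parts. Characteristic vector of a $3$-core $\lambda$: for each diagonal box $d$ of the Young diagram, the arm at $d$ is the number of boxes in the same row strictly to the right of $d$, and the leg at $d$ is the number of boxes in the same column strictly below $d$. Let $\mathcal A_\lambda$ and $\mathcal L_\lambda$ be the sets of arms and of legs. For $i\in\{0,1,2\}$, if no element of $\mathcal L_\lambda$ is congruent to $2-i$ modulo $3$, set $c_i=|\{a\in\mathcal A_\lambda\mid a\equiv i \bmod 3\}|$; otherwise set $c_i=-|\{l\in\mathcal L_\lambda\mid l\equiv 2-i\bmod 3\}|$. The characteristic vector of $\lambda$ is $(c_0,c_1,c_2)$; it satisfies $c_0+c_1+c_2=0$ and is identified with the pair $(x,y)=(c_1,c_2)\in\mathbb Z^2$ (so $(c_0,c_1,c_2)=(-x-y,x,y)$). The map sending a $3$-core to its characteristic vector is a bijection from the set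 of all $3$-cores onto $\{(c_0,c_1,c_2)\in\mathbb Z^3\mid c_0+c_1+c_2=0\}$. $\mathcal C_n\subseteq\mathbb Z^2$ denotes the set of characteristic vectors $(x,y)$ of the $3$-core partitions of size $n$. *)

theory Defs
  imports Complex_Main
begin

text \<open>A partition is the list of its parts in weakly decreasing order; all parts are positive.\<close>

definition is_partition :: "nat list \<Rightarrow> bool" where
  "is_partition p \<longleftrightarrow> sorted_wrt (\<ge>) p \<and> 0 \<notin> set p"

text \<open>Boxes are pairs (row, column), both counted from 0, with row 0 (the largest part) on top.\<close>

definition young_diagram :: "nat list \<Rightarrow> (nat \<times> nat) set" where
  "young_diagram p = {(i, j). i < length p \<and> j < p ! i}"

definition boxes_right :: "nat list \<Rightarrow> nat \<times> nat \<Rightarrow> (nat \<times> nat) set" where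
  "boxes_right p b = {(i, j) \<in> young_diagram p. i = fst b \<and> j > snd b}"

definition boxes_below :: "nat list \<Rightarrow> nat \<times> nat \<Rightarrow> (nat \<times> nat) set" where
  "boxes_below p b = {(i, j) \<in> young_diagram p. j = snd b \<and> i > fst b}"

definition hook :: "nat list \<Rightarrow> nat \<times> nat \<Rightarrow> (nat \<times> nat) set" where
  "hook p b = {b} \<union> boxes_right p b \<union> boxes_below p b"

definition is_3core :: "nat list \<Rightarrow> bool" where
  "is_3core p \<longleftrightarrow> is_partition p \<and> (\<forall>b \<in> young_diagram p. card (hook p b) \<noteq> 3)"

definition arms :: "nat list \<Rightarrow> nat set" where
  "arms p = {card (boxes_right p (d, d)) | d. (d, d) \<in> young_diagram p}"

definition legs :: "nat list \<Rightarrow> nat set" where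
  "legs p = {card (boxes_below p (d, d)) | d. (d, d) \<in> young_diagram p}"

text \<open>Only used for indices \<open>i \<le> 2\<close>, so the subtraction \<open>2 - i\<close> is not truncated.\<close>

definition char_coord :: "nat list \<Rightarrow> nat \<Rightarrow> int" where
  "char_coord p i =
    (if \<forall>l \<in> legs p. l mod 3 \<noteq> 2 - i
     then int (card {a \<in> arms p. a mod 3 = i})
     else - int (card {l \<in> legs p. l mod 3 = 2 - i}))"

text \<open>The coordinates \<open>c\<^sub>0, c\<^sub>1, c\<^sub>2\<close> of a 3-core sum to 0, so its characteristic vector is
  identified with the pair \<open>(c\<^sub>1, c\<^sub>2)\<close>.\<close>

definition char_vector :: "nat list \<Rightarrow> int \<times> int" where
  "char_vector p = (char_coord p 1, char_coord p 2)"

definition core_vectors :: "nat \<Rightarrow> (int \<times> int) set" where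
  "core_vectors n = {char_vector p | p. is_3core p \<and> sum_list p = n}"

definition U_set :: "nat \<Rightarrow> (int \<times> int) set" where
  "U_set k = {(x, y). x^2 + 3 * y^2 = int k}"

end

theory Submission
  imports Defs
begin

text \<open>
  Everything rests on describing the set of characteristic vectors by one equation: \<open>(x, y)\<close> is the
  characteristic vector of a 3-core of size \<open>n\<close> if and only if
  \<open>3x\<^sup>2 + 3xy + 3y\<^sup>2 + x + 2y = n\<close> (lemma \<open>core_vectors_eq\<close>). Multiplying by 12 and adding 4 turns the
  left-hand side into \<open>(6x + 3y + 1)\<^sup>2 + 3(3y + 1)\<^sup>2\<close>, so the first family solves
  \<open>X\<^sup>2 + 3Y\<^sup>2 = 12n + 4\<close>. The other five arise from it by repeated multiplication of
  \<open>X + Y\<surd>(-3)\<close> by the sixth root of unity \<open>(1 + \<surd>(-3))/2\<close>, which preserves the norm. Conversely, a solution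
  has \<open>X \<equiv> Y\<close> modulo 2 and \<open>X\<close> prime to 3, which leaves six classes of \<open>(X, Y)\<close> modulo 3;
  each of the six families parametrises one of them.

  The equation for cores comes from the Maya diagram of a partition \<open>\<lambda>\<close>, the set of the integers (beads)
  \<open>\<lambda>\<^sub>i - i - 1\<close> for all \<open>i \<ge> 0\<close>, where \<open>\<lambda>\<close> is continued by zeros. Its complement consists of the gaps
  \<open>j - \<lambda>'\<^sub>j\<close>, with \<open>\<lambda>'\<close> the conjugate partition (lemma \<open>maya_complement\<close>), and the hook length of the box
  \<open>(i, j)\<close> is the difference of bead \<open>i\<close> and gap \<open>j\<close>. Hence \<open>\<lambda>\<close> is a 3-core if and only if its beads are
  closed under subtracting 3. Then each residue class \<open>r\<close> modulo 3 is filled with beads exactly up to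
  a level: the beads in it are the \<open>r + 3k\<close> with \<open>k < c\<^sub>r\<close>. Arms are the nonnegative beads and legs the
  negative gaps (reflected), so the levels \<open>c\<^sub>r\<close> are precisely the coordinates of the characteristic vector.

  Cutting the beads off far below zero leaves a finite set whose cardinality and sum can be computed in
  two ways, from \<open>\<lambda>\<close> and from the levels. The cardinality gives \<open>c\<^sub>0 + c\<^sub>1 + c\<^sub>2 = 0\<close> and the sum gives the size
  of \<open>\<lambda>\<close> (lemma \<open>size_of_runners\<close>). Finally, all levels of sum 0 occur, since any
  bead configuration with as many beads from 0 on as gaps below 0 comes from a partition
  (lemma \<open>ex_partition_with_beads\<close>).
\<close>

section \<open>Beads and gaps of a partition\<close>

text \<open>Parts are continued by zeros, so that the set of beads needs no choice of a number of parts.\<close>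

definition part :: "nat list \<Rightarrow> nat \<Rightarrow> nat" where
  "part p i = (if i < length p then p ! i else 0)"

definition conj_part :: "nat list \<Rightarrow> nat \<Rightarrow> nat" where
  "conj_part p j = card {i. j < part p i}"

definition bead :: "nat list \<Rightarrow> nat \<Rightarrow> int" where
  "bead p i = int (part p i) - int i - 1"

definition gap :: "nat list \<Rightarrow> nat \<Rightarrow> int" where
  "gap p j = int j - int (conj_part p j)"

definition maya :: "nat list \<Rightarrow> int set" where
  "maya p = range (bead p)"

lemma young_diagram_iff: "(i, j) \<in> young_diagram p \<longleftrightarrow> j < part p i"
  by (auto simp: young_diagram_def part_def)

lemma part_antimono:
  assumes "is_partition p" "i \<le> k"
  shows "part p k \<le> part p i"
proof (cases "i = k")
  case False
  with assms show ?thesis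
    by (auto simp: part_def is_partition_def sorted_wrt_iff_nth_less)
qed simp

text \<open>Column \<open>j\<close> of the diagram is an initial segment of rows, because the parts decrease; its
  length is therefore also the threshold for the rows that reach it.\<close>

lemma part_gt_iff_conj_part_gt:
  assumes "is_partition p"
  shows "j < part p i \<longleftrightarrow> i < conj_part p j"
proof -
  let ?A = "{i. j < part p i}"
  have sub: "?A \<subseteq> {..<length p}"
    by (auto simp: part_def split: if_splits)
  hence fin: "finite ?A"
    by (rule finite_subset) simp
  have down: "k \<in> ?A" if "i \<in> ?A" "k \<le> i" for i k
    using part_antimono[OF assms that(2)] that(1) by simp
  show ?thesis
  proof
    assume "j < part p i"
    hence "{..i} \<subseteq> ?A"
      using down by blast
    from card_mono[OF fin this] show "i < conj_part p j"
      by (simp add: conj_part_def)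
  next
    assume less: "i < conj_part p j"
    show "j < part p i"
    proof (rule ccontr)
      assume "\<not> j < part p i"
      hence "?A \<subseteq> {..<i}"
        using down by (metis lessThan_iff linorder_not_less mem_Collect_eq subsetI)
      from card_mono[OF _ this] less show False
        by (simp add: conj_part_def)
    qed
  qed
qed

lemma bead_strict_antimono:
  assumes "is_partition p" "i < k"
  shows "bead p k < bead p i"
  using part_antimono[OF assms(1), of i k] assms(2) by (simp add: bead_def)

lemma inj_bead: "is_partition p \<Longrightarrow> inj (bead p)"
  using bead_strict_antimono
  by (intro injI) (metis less_irrefl linorder_neqE_nat)

text \<open>Beads label the vertical and gaps the horizontal steps of the boundary path of the diagram; a box
  is a pair of such steps with the gap first.\<close>

lemma bead_less_gap_iff:
  assumes "is_partition p"
  shows "bead p i < gap p j \<longleftrightarrow> \<not> j < part p i"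
    and "gap p j < bead p i \<longleftrightarrow> j < part p i"
  using part_gt_iff_conj_part_gt[OF assms, of j i]
  by (auto simp: bead_def gap_def)

text \<open>Each step of the boundary path is either vertical or horizontal. Given an integer \<open>t\<close> that is not a
  bead, let \<open>i\<close> be the number of beads above \<open>t\<close>; then the column of index \<open>t + i\<close> has length
  \<open>i\<close>, which exhibits \<open>t\<close> as a gap.\<close>

lemma maya_complement:
  assumes "is_partition p"
  shows "- maya p = range (gap p)"
proof (intro equalityI subsetI)
  fix t assume "t \<in> range (gap p)"
  then show "t \<in> - maya p"
    using bead_less_gap_iff[OF assms] unfolding maya_def
    by (metis ComplI imageE less_irrefl)
next
  fix t assume t: "t \<in> - maya p"
  have "bead p (length p + nat (- t)) < t"
    by (simp add: bead_def part_def)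
  \<comment> \<open>As beads decrease, this index is the number of beads above \<open>t\<close>.\<close>
  define i where "i = (LEAST i. bead p i < t)"
  have i: "bead p i < t"
    unfolding i_def by (rule LeastI) fact
  have above: "t < bead p k" if "k < i" for k
  proof -
    have "\<not> bead p k < t"
      using not_less_Least that unfolding i_def by blast
    moreover have "bead p k \<noteq> t"
      using t by (auto simp: maya_def)
    ultimately show ?thesis by simp
  qed
  have nonneg: "0 \<le> t + int i" and le: "int (part p i) \<le> t + int i"
    using i by (auto simp: bead_def)
  define j where "j = nat (t + int i)"
  have "part p i \<le> j"
    using le unfolding j_def by linarith
  hence "\<not> i < conj_part p j"
    using part_gt_iff_conj_part_gt[OF assms, of j i] by simp
  moreover have "k < conj_part p j" if "Suc k = i" for k
    using above[of k] that nonneg part_gt_iff_conj_part_gt[OF assms, of j k]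
    by (auto simp: j_def bead_def)
  ultimately have "conj_part p j = i"
    by (cases i) (auto simp: less_Suc_eq not_less le_antisym)
  hence "t = gap p j"
    using nonneg by (simp add: gap_def j_def)
  thus "t \<in> range (gap p)" by simp
qed

section \<open>Hooks, arms and legs\<close>

lemma boxes_right_eq: "boxes_right p (i, j) = {i} \<times> {j<..<part p i}"
  by (auto simp: boxes_right_def young_diagram_iff)

lemma boxes_below_eq:
  assumes "is_partition p"
  shows "boxes_below p (i, j) = {i<..<conj_part p j} \<times> {j}"
  by (auto simp: boxes_below_def young_diagram_iff part_gt_iff_conj_part_gt[OF assms])

lemma card_hook:
  assumes p: "is_partition p" and box: "(i, j) \<in> young_diagram p"
  shows "int (card (hook p (i, j))) = bead p i - gap p j"
proof -
  have "card (hook p (i, j)) = 1 + (part p i - Suc j) + (conj_part p j - Suc i)"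
    unfolding hook_def boxes_right_eq boxes_below_eq[OF p]
    by (subst card_Un_disjoint; auto simp: card_cartesian_product)+
  moreover have "j < part p i" "i < conj_part p j"
    using box part_gt_iff_conj_part_gt[OF p] by (auto simp: young_diagram_iff)
  ultimately show ?thesis
    by (simp add: bead_def gap_def)
qed

text \<open>A hook of length 3 is a bead \<open>s\<close> for which \<open>s - 3\<close> is a gap.\<close>

lemma is_3core_iff_maya:
  assumes p: "is_partition p"
  shows "is_3core p \<longleftrightarrow> (\<forall>s \<in> maya p. s - 3 \<in> maya p)"
proof -
  have "is_3core p \<longleftrightarrow> (\<forall>i j. gap p j < bead p i \<longrightarrow> bead p i - gap p j \<noteq> 3)"
    using p card_hook[OF p] bead_less_gap_iff(2)[OF p]
    by (force simp: is_3core_def young_diagram_iff)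
  also have "\<dots> \<longleftrightarrow> (\<forall>i j. bead p i - 3 \<noteq> gap p j)"
    by (metis add.commute add_diff_cancel_right' diff_add_cancel less_add_same_cancel1
        zero_less_numeral)
  also have "\<dots> \<longleftrightarrow> (\<forall>s \<in> maya p. s - 3 \<notin> range (gap p))"
    unfolding maya_def by blast
  also have "\<dots> \<longleftrightarrow> (\<forall>s \<in> maya p. s - 3 \<in> maya p)"
    using maya_complement[OF p] by blast
  finally show ?thesis .
qed

lemma arms_iff_maya:
  assumes p: "is_partition p"
  shows "a \<in> arms p \<longleftrightarrow> int a \<in> maya p"
proof -
  have "a \<in> arms p \<longleftrightarrow> (\<exists>d. a = part p d - Suc d \<and> d < part p d)"
    by (auto simp: arms_def boxes_right_eq young_diagram_iff card_cartesian_product)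
  also have "\<dots> \<longleftrightarrow> (\<exists>d. int a = bead p d)"
    by (rule arg_cong[of _ _ Ex]) (auto simp: bead_def)
  finally show ?thesis
    by (auto simp: maya_def)
qed

text \<open>The diagonal box \<open>d\<close> exists if and only if gap \<open>d\<close> is negative, and its leg is then the gap reflected
  by \<open>t \<mapsto> -1 - t\<close>.\<close>

lemma legs_iff_maya:
  assumes p: "is_partition p"
  shows "l \<in> legs p \<longleftrightarrow> - 1 - int l \<notin> maya p"
proof -
  have "l \<in> legs p \<longleftrightarrow> (\<exists>d. l = conj_part p d - Suc d \<and> d < conj_part p d)"
    by (auto simp: legs_def boxes_below_eq[OF p] young_diagram_iff
        part_gt_iff_conj_part_gt[OF p] card_cartesian_product)
  also have "\<dots> \<longleftrightarrow> (\<exists>d. - 1 - int l = gap p d)"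
    by (rule arg_cong[of _ _ Ex]) (auto simp: gap_def)
  also have "\<dots> \<longleftrightarrow> - 1 - int l \<notin> maya p"
    using maya_complement[OF p] by blast
  finally show ?thesis .
qed

section \<open>Three-cores as runners filled to prescribed levels\<close>

text \<open>The abacus with three runners: in the residue class \<open>r\<close> modulo 3, exactly the positions
  below \<open>r + 3 c r\<close> carry a bead.\<close>

definition runners :: "(int \<Rightarrow> int) \<Rightarrow> int set" where
  "runners c = {s. s div 3 < c (s mod 3)}"

lemma runners_diff_3: "s \<in> runners c \<Longrightarrow> s - 3 \<in> runners c"
proof -
  have "(s - 3) div 3 = s div 3 - 1" "(s - 3) mod 3 = s mod 3"
    by presburger+
  then show "s \<in> runners c \<Longrightarrow> s - 3 \<in> runners c"
    by (simp add: runners_def)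
qed

lemma in_runners_iff:
  assumes "0 \<le> r" "r < 3"
  shows "r + 3 * k \<in> runners c \<longleftrightarrow> k < c r"
  using assms by (simp add: runners_def)

lemma maya_upper:
  assumes "is_partition p" "s \<in> maya p"
  shows "s < int (part p 0)"
proof -
  from assms(2) obtain i where "s = bead p i" by (auto simp: maya_def)
  with part_antimono[OF assms(1), of 0 i] show ?thesis
    by (simp add: bead_def)
qed

lemma maya_lower:
  assumes "s < - int (length p)"
  shows "s \<in> maya p"
proof -
  from assms have "s = bead p (nat (- s - 1))"
    by (auto simp: bead_def part_def)
  thus ?thesis unfolding maya_def by (rule range_eqI)
qed

lemma downset_int:
  fixes K :: "int set"
  assumes down: "\<And>k. k \<in> K \<Longrightarrow> k - 1 \<in> K"
    and "a \<in> K" and up: "\<And>k. k \<in> K \<Longrightarrow> k < b"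
  shows "\<exists>m. K = {..<m}"
proof -
  have down_le: "k - int n \<in> K" if "k \<in> K" for k n
  proof (induction n)
    case (Suc n)
    from down[OF Suc] show ?case by (simp add: algebra_simps)
  qed (use that in simp)
  define A where "A = K \<inter> {a..}"
  have fin: "finite A"
    by (rule finite_subset[of _ "{a..<b}"]) (use up in \<open>auto simp: A_def\<close>)
  have aA: "a \<in> A"
    using \<open>a \<in> K\<close> by (simp add: A_def)
  have M: "Max A \<in> K"
    using Max_in[OF fin] aA by (auto simp: A_def)
  have "K = {..<Max A + 1}"
  proof (intro equalityI subsetI)
    fix k assume "k \<in> K"
    show "k \<in> {..<Max A + 1}"
      using Max_ge[OF fin, of k] Max_ge[OF fin aA] \<open>k \<in> K\<close>
      by (cases "a \<le> k") (auto simp: A_def)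
  next
    fix k assume "k \<in> {..<Max A + 1}"
    with down_le[OF M, of "nat (Max A - k)"] show "k \<in> K"
      by simp
  qed
  thus ?thesis ..
qed

text \<open>On each residue class the beads of a core form a down-closed set, which is bounded above by the
  first part and nonempty because all sufficiently small integers are beads.\<close>

lemma core_maya_eq_runners:
  assumes core: "is_3core p"
  shows "\<exists>c. maya p = runners c"
proof -
  have p: "is_partition p"
    using core by (simp add: is_3core_def)
  have "\<exists>m. {k. r + 3 * k \<in> maya p} = {..<m}" if r: "0 \<le> r" "r < 3" for r
  proof (rule downset_int)
    fix k assume "k \<in> {k. r + 3 * k \<in> maya p}"
    hence "r + 3 * k - 3 \<in> maya p"
      using core is_3core_iff_maya[OF p] by blast
    thus "k - 1 \<in> {k. r + 3 * k \<in> maya p}"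
      by (simp add: algebra_simps)
  next
    show "- int (length p) - 1 \<in> {k. r + 3 * k \<in> maya p}"
      using r by (auto intro: maya_lower)
  next
    fix k assume "k \<in> {k. r + 3 * k \<in> maya p}"
    from maya_upper[OF p] this r show "k < int (part p 0) + 1"
      by fastforce
  qed
  then obtain c where c: "\<And>r. 0 \<le> r \<Longrightarrow> r < 3 \<Longrightarrow> {k. r + 3 * k \<in> maya p} = {..<c r}"
    by metis
  have "s \<in> maya p \<longleftrightarrow> s \<in> runners c" for s
  proof -
    have "s div 3 \<in> {k. s mod 3 + 3 * k \<in> maya p} \<longleftrightarrow> s \<in> runners c"
      by (subst c) (auto simp: runners_def)
    thus ?thesis by simp
  qed
  thus ?thesis by blast
qed

text \<open>If the level is nonnegative, the nonnegative positions below it are the arms in the class and there is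
  no leg. If it is negative, the negative positions from the level on are gaps; the reflection
  \<open>t \<mapsto> -1 - t\<close> carries the class \<open>i\<close> to \<open>2 - i\<close>, so the legs in that class count them.\<close>

lemma char_coord_eq_level:
  assumes p: "is_partition p" and maya: "maya p = runners c" and i: "i < 3"
  shows "char_coord p i = c (int i)"
proof -
  have arm: "i + 3 * k \<in> arms p \<longleftrightarrow> int k < c (int i)" for k
    using in_runners_iff[of "int i" "int k" c] i
    by (simp add: arms_iff_maya[OF p] maya)
  have leg: "2 - i + 3 * k \<in> legs p \<longleftrightarrow> c (int i) < - int k" for k
  proof -
    have eq: "- 1 - int (2 - i + 3 * k) = int i + 3 * (- 1 - int k)"
      using i by auto
    have "2 - i + 3 * k \<in> legs p \<longleftrightarrow> int i + 3 * (- 1 - int k) \<notin> runners c"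
      by (simp only: legs_iff_maya[OF p] maya eq)
    also have "\<dots> \<longleftrightarrow> \<not> - 1 - int k < c (int i)"
      using i by (subst in_runners_iff) auto
    finally show ?thesis by auto
  qed
  have arms: "{a \<in> arms p. a mod 3 = i} = (\<lambda>k. i + 3 * k) ` {..<nat (c (int i))}"
  proof (intro equalityI subsetI)
    fix a assume a: "a \<in> {a \<in> arms p. a mod 3 = i}"
    hence eq: "i + 3 * (a div 3) = a"
      using mod_mult_div_eq[of a 3] by simp
    hence "a div 3 < nat (c (int i))"
      using a arm[of "a div 3"] by simp
    thus "a \<in> (\<lambda>k. i + 3 * k) ` {..<nat (c (int i))}" 
      by (intro image_eqI[of _ _ "a div 3"]) (simp_all only: eq lessThan_iff)
  next
    fix a assume "a \<in> (\<lambda>k. i + 3 * k) ` {..<nat (c (int i))}"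
    thus "a \<in> {a \<in> arms p. a mod 3 = i}"
      using i by (auto simp: arm)
  qed
  have legs: "{l \<in> legs p. l mod 3 = 2 - i} = (\<lambda>k. 2 - i + 3 * k) ` {..<nat (- c (int i))}"
  proof (intro equalityI subsetI)
    fix l assume l: "l \<in> {l \<in> legs p. l mod 3 = 2 - i}"
    hence eq: "2 - i + 3 * (l div 3) = l"
      using mod_mult_div_eq[of l 3] by simp
    hence "l div 3 < nat (- c (int i))"
      using l leg[of "l div 3"] by simp
    thus "l \<in> (\<lambda>k. 2 - i + 3 * k) ` {..<nat (- c (int i))}" 
      by (intro image_eqI[of _ _ "l div 3"]) (simp_all only: eq lessThan_iff)
  next
    fix l assume "l \<in> (\<lambda>k. 2 - i + 3 * k) ` {..<nat (- c (int i))}"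
    then obtain k where "l = 2 - i + 3 * k" "c (int i) < - int k"
      by auto
    thus "l \<in> {l \<in> legs p. l mod 3 = 2 - i}"
      using i leg[of k] mod_mult_self2[of "2 - i" 3 k] by simp
  qed
  have "card {a \<in> arms p. a mod 3 = i} = nat (c (int i))"
    unfolding arms by (simp add: card_image inj_on_def)
  moreover have "card {l \<in> legs p. l mod 3 = 2 - i} = nat (- c (int i))"
    unfolding legs by (simp add: card_image inj_on_def)
  moreover have "(\<forall>l \<in> legs p. l mod 3 \<noteq> 2 - i) \<longleftrightarrow> 0 \<le> c (int i)"
  proof -
    have "(\<forall>l \<in> legs p. l mod 3 \<noteq> 2 - i) \<longleftrightarrow> {l \<in> legs p. l mod 3 = 2 - i} = {}"
      by blast
    also have "\<dots> \<longleftrightarrow> 0 \<le> c (int i)"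
      unfolding legs by (auto simp: lessThan_empty_iff)
    finally show ?thesis .
  qed
  ultimately show ?thesis
    by (simp add: char_coord_def)
qed

section \<open>Counting and summing beads\<close>

lemma runners_truncated:
  "runners c \<inter> {- 3 * M..} = (\<Union>r\<in>{0, 1, 2}. (\<lambda>k. r + 3 * k) ` {- M..<c r})"
proof (intro equalityI subsetI)
  fix s assume s: "s \<in> runners c \<inter> {- 3 * M..}"
  have "s div 3 \<in> {- M..<c (s mod 3)}"
    using s by (auto simp: runners_def)
  hence "s \<in> (\<lambda>k. s mod 3 + 3 * k) ` {- M..<c (s mod 3)}"
    by (intro image_eqI[of _ _ "s div 3"]) simp_all
  moreover have "s mod 3 \<in> {0, 1, 2}" by (simp, presburger)
  ultimately show "s \<in> (\<Union>r\<in>{0, 1, 2}. (\<lambda>k. r + 3 * k) ` {- M..<c r})"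
    by (rule UN_I[rotated])
next
  fix s assume "s \<in> (\<Union>r\<in>{0, 1, 2}. (\<lambda>k. r + 3 * k) ` {- M..<c r})"
  thus "s \<in> runners c \<inter> {- 3 * M..}"
    by (auto simp: runners_def)
qed

lemma sum_runners_truncated:
  fixes g :: "int \<Rightarrow> int"
  shows "sum g (runners c \<inter> {- 3 * M..}) = (\<Sum>r\<in>{0, 1, 2}. \<Sum>k\<in>{- M..<c r}. g (r + 3 * k))"
proof -
  have "sum g (runners c \<inter> {- 3 * M..})
      = (\<Sum>r\<in>{0, 1, 2}. sum g ((\<lambda>k. r + 3 * k) ` {- M..<c r}))"
    unfolding runners_truncated
  proof (rule sum.UNION_disjoint)
    show "\<forall>r\<in>{0, 1, 2}. \<forall>q\<in>{0, 1, 2}. r \<noteq> q \<longrightarrow>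
        (\<lambda>k. r + 3 * k) ` {- M..<c r} \<inter> (\<lambda>k. q + 3 * k) ` {- M..<c q} = {}"
      by (auto; presburger)
  qed auto
  also have "\<dots> = (\<Sum>r\<in>{0, 1, 2}. \<Sum>k\<in>{- M..<c r}. g (r + 3 * k))"
    by (rule sum.cong[OF refl]) (simp add: sum.reindex inj_on_def)
  finally show ?thesis .
qed

lemma sum_int_interval:
  fixes a b :: int
  assumes "a \<le> b"
  shows "2 * (\<Sum>k\<in>{a..<b}. k) = b * (b - 1) - a * (a - 1)"
  using assms
proof (induction b rule: int_ge_induct)
  case (step b)
  have "{a..<b + 1} = insert b {a..<b}"
    using step.hyps by auto
  with step.IH show ?case
    by (simp add: algebra_simps)
qed simp

lemma card_runners_truncated:
  assumes "- M \<le> c 0" "- M \<le> c 1" "- M \<le> c 2"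
  shows "int (card (runners c \<inter> {- 3 * M..})) = c 0 + c 1 + c 2 + 3 * M"
  using sum_runners_truncated[of "\<lambda>_. 1" c M] assms by simp

lemma finite_runners_truncated: "finite (runners c \<inter> {- 3 * M..})"
  unfolding runners_truncated by simp

text \<open>The sum over runner \<open>r\<close> is an arithmetic progression. The factor 2 avoids the
  halves in its closed form.\<close>

lemma sum_beads_runners_truncated:
  assumes "- M \<le> c 0" "- M \<le> c 1" "- M \<le> c 2"
  shows "2 * \<Sum>(runners c \<inter> {- 3 * M..}) =
    3 * ((c 0)\<^sup>2 + (c 1)\<^sup>2 + (c 2)\<^sup>2) - 3 * c 0 - c 1 + c 2 - 9 * M\<^sup>2 - 3 * M"
proof -
  have run: "2 * (\<Sum>k\<in>{- M..<c r}. r + 3 * k)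
      = 2 * r * (c r + M) + 3 * (c r * (c r - 1) - M * (M + 1))" if "- M \<le> c r" for r
  proof -
    have "(\<Sum>k\<in>{- M..<c r}. r + 3 * k) = r * (c r + M) + 3 * (\<Sum>k\<in>{- M..<c r}. k)"
      using that by (simp add: sum.distrib sum_distrib_left)
    with sum_int_interval[OF that] show ?thesis
      by (simp add: algebra_simps)
  qed
  have total: "\<Sum>(runners c \<inter> {- 3 * M..})
      = (\<Sum>r\<in>{0, 1, 2}. \<Sum>k\<in>{- M..<c r}. r + 3 * k)"
    by (rule sum_runners_truncated)
  show ?thesis
    unfolding total using run[of 0] run[of 1] run[of 2] assms
    by (simp add: power2_eq_square algebra_simps)
qed

lemma maya_truncated:
  assumes "length p \<le> N"
  shows "maya p \<inter> {- int N..} = bead p ` {..<N}"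
proof -
  have "- int N \<le> bead p i \<longleftrightarrow> i < N" for i
    using assms by (auto simp: bead_def part_def)
  thus ?thesis by (auto simp: maya_def)
qed

lemma sum_list_eq_sum_part:
  assumes "length p \<le> N"
  shows "sum_list p = (\<Sum>i<N. part p i)"
proof -
  have "sum_list p = (\<Sum>i<length p. part p i)"
    by (simp add: sum_list_sum_nth atLeast0LessThan part_def)
  also have "\<dots> = (\<Sum>i<N. part p i)"
    using assms by (intro sum.mono_neutral_left) (auto simp: part_def)
  finally show ?thesis .
qed

text \<open>Row \<open>i\<close> contributes its part minus \<open>i + 1\<close>, so the sum of the beads is the size up to a
  triangular number.\<close>

lemma sum_maya_truncated:
  assumes p: "is_partition p" and N: "length p \<le> N"
  shows "2 * \<Sum>(maya p \<inter> {- int N..}) = 2 * int (sum_list p) - int N * (int N + 1)"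
proof -
  have "\<Sum>(maya p \<inter> {- int N..}) = (\<Sum>i<N. bead p i)"
    unfolding maya_truncated[OF N]
    by (subst sum.reindex) (auto intro: inj_on_subset[OF inj_bead[OF p]])
  also have "\<dots> = int (sum_list p) - (\<Sum>i<N. int i + 1)"
    by (simp add: sum_list_eq_sum_part[OF N] bead_def sum_subtractf sum.distrib)
  finally have "\<Sum>(maya p \<inter> {- int N..}) = int (sum_list p) - (\<Sum>i<N. int i + 1)" .
  moreover have "2 * (\<Sum>i<N. int i + 1) = int N * (int N + 1)"
    by (induction N) (auto simp: algebra_simps)
  ultimately show ?thesis by simp
qed

text \<open>The beads from \<open>-3M\<close> on, for large \<open>M\<close>, are counted and summed in two ways; all terms in \<open>M\<close>
  cancel. The bound is a multiple of 3 so that it cuts all three runners at the same height.\<close>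

lemma size_of_runners:
  assumes p: "is_partition p" and maya: "maya p = runners c"
  shows "c 0 + c 1 + c 2 = 0"
    and "2 * int (sum_list p) = 3 * ((c 0)\<^sup>2 + (c 1)\<^sup>2 + (c 2)\<^sup>2) + 2 * c 1 + 4 * c 2"
proof -
  \<comment> \<open>Large enough that \<open>-3m\<close> lies below the beads of all nonempty rows and below the tops of all runners.\<close>
  define m where "m = length p + nat (\<bar>c 0\<bar> + \<bar>c 1\<bar> + \<bar>c 2\<bar>)"
  define M where "M = int m"
  have M: "- M \<le> c 0" "- M \<le> c 1" "- M \<le> c 2"
    by (auto simp: M_def m_def)
  have len: "length p \<le> 3 * m"
    by (simp add: m_def)
  have N: "{- int (3 * m)..} = {- 3 * M..}"
    by (simp add: M_def)
  have "card (maya p \<inter> {- int (3 * m)..}) = 3 * m"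
    unfolding maya_truncated[OF len]
    by (subst card_image) (auto intro: inj_on_subset[OF inj_bead[OF p]])
  with card_runners_truncated[of M c] M show zero: "c 0 + c 1 + c 2 = 0"
    by (simp add: maya N M_def)
  from sum_maya_truncated[OF p len] sum_beads_runners_truncated[of M c] M
  have "2 * int (sum_list p) = 3 * M * (3 * M + 1) +
      (3 * ((c 0)\<^sup>2 + (c 1)\<^sup>2 + (c 2)\<^sup>2) - 3 * c 0 - c 1 + c 2 - 9 * M\<^sup>2 - 3 * M)"
    by (simp add: maya N M_def)
  also have "\<dots> = 3 * ((c 0)\<^sup>2 + (c 1)\<^sup>2 + (c 2)\<^sup>2) - 3 * (c 0 + c 1 + c 2) + 2 * c 1 + 4 * c 2"
    by (simp add: algebra_simps power2_eq_square)
  finally show "2 * int (sum_list p) = 3 * ((c 0)\<^sup>2 + (c 1)\<^sup>2 + (c 2)\<^sup>2) + 2 * c 1 + 4 * c 2"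
    using zero by simp
qed

section \<open>Reconstructing a partition from its beads\<close>

lemma maya_Nil: "maya [] = {..<0}"
proof -
  have "s \<in> maya []" if "s < 0" for s
    using maya_lower[of s "[]"] that by simp
  moreover have "s < 0" if "s \<in> maya []" for s
    using that by (auto simp: maya_def bead_def part_def)
  ultimately show ?thesis by auto
qed

text \<open>A new first row shifts all the other rows down by one.\<close>

lemma maya_Cons: "maya (a # p) = insert (int a - 1) ((\<lambda>s. s - 1) ` maya p)"
proof -
  have zero: "bead (a # p) 0 = int a - 1"
    by (simp add: bead_def part_def)
  have Suc: "bead (a # p) (Suc i) = bead p i - 1" for i
    by (simp add: bead_def part_def)
  have "maya (a # p) = insert (bead (a # p) 0) (range (\<lambda>i. bead (a # p) (Suc i)))"
  proof -
    have "(UNIV :: nat set) = insert 0 (range Suc)"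
      using not0_implies_Suc by blast
    thus ?thesis
      unfolding maya_def by (metis image_image image_insert)
  qed
  thus ?thesis
    by (simp add: zero Suc maya_def image_image)
qed

text \<open>The largest bead determines the first part; removing it and shifting the rest up by one gives the
  beads of the remaining rows. The recursion ends when the largest bead is negative: then the beads fill
  all negative integers, and the partition is empty.\<close>

lemma ex_partition_with_beads:
  fixes T :: "int set"
  assumes "finite T" "card T = N" "T \<subseteq> {- int N..}"
  shows "\<exists>p. is_partition p \<and> maya p = T \<union> {..<- int N}"
  using assms
proof (induction N arbitrary: T)
  case 0
  have "is_partition []" by (simp add: is_partition_def)
  with 0 maya_Nil show ?case by auto
next
  case (Suc N)
  define m where "m = Max T"
  have "T \<noteq> {}" using Suc.prems by auto
  hence m: "m \<in> T" and le: "\<And>t. t \<in> T \<Longrightarrow> t \<le> m"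
    using Suc.prems(1) by (auto simp: m_def)
  show ?case
  proof (cases "m < 0")
    case True
    have "T \<subseteq> {- int (Suc N)..<0}"
      using Suc.prems(3) le True by fastforce
    hence "T = {- int (Suc N)..<0}"
      by (rule card_subset_eq[rotated]) (use Suc.prems in auto)
    hence "maya [] = T \<union> {..<- int (Suc N)}"
      by (auto simp: maya_Nil)
    moreover have "is_partition []" by (simp add: is_partition_def)
    ultimately show ?thesis by blast
  next
    case False
    define T' where "T' = (\<lambda>t. t + 1) ` (T - {m})"
    have "\<exists>p. is_partition p \<and> maya p = T' \<union> {..<- int N}"
    proof (rule Suc.IH)
      show "finite T'" "card T' = N"
        using Suc.prems m by (auto simp: T'_def card_image)
      show "T' \<subseteq> {- int N..}"
        using Suc.prems(3) by (force simp: T'_def)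
    qed
    then obtain p where p: "is_partition p" and maya: "maya p = T' \<union> {..<- int N}"
      by blast
    have first: "part p 0 \<le> nat (m + 1)"
    proof -
      have "bead p 0 \<in> T' \<union> {..<- int N}"
        unfolding maya[symmetric] maya_def by (rule rangeI)
      hence "int (part p 0) - 1 \<in> T' \<union> {..<- int N}"
        by (simp add: bead_def)
      thus ?thesis
        using le False by (force simp: T'_def)
    qed
    have "is_partition (nat (m + 1) # p)"
    proof -
      have "x \<le> nat (m + 1)" if "x \<in> set p" for x
      proof -
        from that obtain i where "i < length p" "x = p ! i"
          by (auto simp: in_set_conv_nth)
        hence "x = part p i" by (simp add: part_def)
        with part_antimono[OF p, of 0 i] first show ?thesis by simp
      qed
      with p False show ?thesis by (auto simp: is_partition_def)
    qed
    moreover have "maya (nat (m + 1) # p) = T \<union> {..<- int (Suc N)}"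
    proof -
      have shift: "(\<lambda>s. s - 1) ` {..<- int N} = {..<- int (Suc N)}"
      proof (intro equalityI subsetI)
        fix s assume "s \<in> {..<- int (Suc N)}"
        thus "s \<in> (\<lambda>s. s - 1) ` {..<- int N}"
          by (intro image_eqI[of _ _ "s + 1"]) auto
      qed auto
      show ?thesis
        using False m by (auto simp: maya_Cons maya image_Un shift T'_def image_image)
    qed
    ultimately show ?thesis by blast
  qed
qed

lemma ex_partition_with_runners:
  assumes "c 0 + c 1 + c 2 = 0"
  shows "\<exists>p. is_partition p \<and> maya p = runners c"
proof -
  define m where "m = nat (\<bar>c 0\<bar> + \<bar>c 1\<bar> + \<bar>c 2\<bar>)"
  have M: "- int m \<le> c 0" "- int m \<le> c 1" "- int m \<le> c 2"
    by (auto simp: m_def)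
  have "\<exists>p. is_partition p \<and> maya p = runners c \<inter> {- 3 * int m..} \<union> {..<- int (3 * m)}"
  proof (rule ex_partition_with_beads)
    show "card (runners c \<inter> {- 3 * int m..}) = 3 * m"
      using card_runners_truncated[of "int m" c] M assms by simp
  qed (use finite_runners_truncated[of c "int m"] in auto)
  moreover have "s \<in> runners c" if "s < - 3 * int m" for s
  proof -
    have "s div 3 < - int m" using that by auto
    moreover have "s mod 3 \<in> {0, 1, 2}" by (simp, presburger)
    ultimately show ?thesis
      using M by (auto simp: runners_def)
  qed
  hence "runners c \<inter> {- 3 * int m..} \<union> {..<- int (3 * m)} = runners c"
    by auto
  ultimately show ?thesis by simp
qed

section \<open>The size of a three-core as a quadratic form\<close>

text \<open>Substituting \<open>c\<^sub>0 = -x - y\<close> into the size formula of a core. For the converse inclusion, the levels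
  \<open>(-x - y, x, y)\<close> are realised by a partition, which is a core because runners are closed under
  subtracting 3.\<close>

lemma core_vectors_eq:
  "core_vectors n = {(x, y). 3 * x\<^sup>2 + 3 * x * y + 3 * y\<^sup>2 + x + 2 * y = int n}"
proof (intro equalityI subsetI)
  fix v assume "v \<in> core_vectors n"
  then obtain p where core: "is_3core p" and n: "sum_list p = n" and v: "v = char_vector p"
    by (auto simp: core_vectors_def)
  have p: "is_partition p"
    using core by (simp add: is_3core_def)
  obtain c where maya: "maya p = runners c"
    using core_maya_eq_runners[OF core] by blast
  have "v = (c 1, c 2)"
    using char_coord_eq_level[OF p maya, of 1] char_coord_eq_level[OF p maya, of 2]
    by (simp add: v char_vector_def)
  moreover have "c 0 = - c 1 - c 2"
    using size_of_runners(1)[OF p maya] by simp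
  with size_of_runners(2)[OF p maya] n
  have "3 * (c 1)\<^sup>2 + 3 * c 1 * c 2 + 3 * (c 2)\<^sup>2 + c 1 + 2 * c 2 = int n"
    by (simp add: power2_eq_square algebra_simps)
  ultimately show "v \<in> {(x, y). 3 * x\<^sup>2 + 3 * x * y + 3 * y\<^sup>2 + x + 2 * y = int n}"
    by simp
next
  fix v :: "int \<times> int"
  assume "v \<in> {(x, y). 3 * x\<^sup>2 + 3 * x * y + 3 * y\<^sup>2 + x + 2 * y = int n}"
  then obtain x y where v: "v = (x, y)"
    and n: "3 * x\<^sup>2 + 3 * x * y + 3 * y\<^sup>2 + x + 2 * y = int n"
    by auto
  define c where "c r = (if r = 0 then - x - y else if r = 1 then x else y)" for r :: int
  have c: "c 0 = - x - y" "c 1 = x" "c 2 = y"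
    by (auto simp: c_def)
  obtain p where p: "is_partition p" and maya: "maya p = runners c"
    using ex_partition_with_runners[of c] c by auto
  have "is_3core p"
    using is_3core_iff_maya[OF p] runners_diff_3 by (simp add: maya)
  moreover have "v = char_vector p"
    using char_coord_eq_level[OF p maya, of 1] char_coord_eq_level[OF p maya, of 2]
    by (simp add: v c char_vector_def)
  moreover have "int (sum_list p) = int n"
    using size_of_runners(2)[OF p maya] n by (simp add: c power2_eq_square algebra_simps)
  ultimately show "v \<in> core_vectors n"
    by (auto simp: core_vectors_def)
qed

section \<open>Representations by the form \<open>x\<^sup>2 + 3y\<^sup>2\<close>\<close>

lemma congruences_of_representation:
  fixes X Y :: int
  assumes "X\<^sup>2 + 3 * Y\<^sup>2 = 12 * k + 4"
  shows "2 dvd X - Y" and "X mod 3 = 1 \<or> X mod 3 = 2"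
proof -
  have "even (X\<^sup>2 + 3 * Y\<^sup>2)" unfolding assms by simp
  thus "2 dvd X - Y" by simp
  have "\<not> 3 dvd X"
  proof
    assume "3 dvd X"
    hence "3 dvd X\<^sup>2 + 3 * Y\<^sup>2" by (simp add: power2_eq_square)
    thus False unfolding assms by presburger
  qed
  thus "X mod 3 = 1 \<or> X mod 3 = 2" by presburger
qed

lemma six_dvd: "2 dvd z \<Longrightarrow> 3 dvd z \<Longrightarrow> 6 dvd z" for z :: int
  by presburger

text \<open>The pairs of residues \<open>(X mod 3, Y mod 3)\<close> with \<open>X\<close> prime to 3 match the families one to one. In
  each case, solving the two linear equations for \<open>x\<close> and \<open>y\<close> needs division by 3 or 6 only, which the
  congruences permit.\<close>

lemma six_families_cover:
  fixes X Y :: int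
  assumes par: "2 dvd X - Y" and X: "X mod 3 = 1 \<or> X mod 3 = 2"
  obtains x y where "(X, Y) \<in>
      {(6*x + 3*y + 1, 3*y + 1),
       (3*x - 3*y - 1, 3*x + 3*y + 1),
       (- 3*x - 6*y - 2, 3*x),
       (- 6*x - 3*y - 1, - 3*y - 1),
       (- 3*x + 3*y + 1, - 3*x - 3*y - 1),
       (3*x + 6*y + 2, - 3*x)}"
proof -
  have "Y mod 3 = 0 \<or> Y mod 3 = 1 \<or> Y mod 3 = 2" by presburger
  then consider
      "X mod 3 = 1" "Y mod 3 = 1" | "X mod 3 = 2" "Y mod 3 = 1" | "X mod 3 = 1" "Y mod 3 = 0"
    | "X mod 3 = 2" "Y mod 3 = 2" | "X mod 3 = 1" "Y mod 3 = 2" | "X mod 3 = 2" "Y mod 3 = 0"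
    using X by blast
  then show ?thesis
  proof cases
    case 1
    have "6 dvd X - Y" "3 dvd Y - 1"
      using par 1 by (auto intro!: six_dvd) presburger+
    then obtain x y where "X - Y = 6 * x" "Y - 1 = 3 * y"
      by (elim dvdE)
    thus ?thesis
      by (intro that[of x y]) simp
  next
    case 2
    have "6 dvd X + Y" "6 dvd Y - X - 2"
      using par 2 by (auto intro!: six_dvd) presburger+
    then obtain x y where "X + Y = 6 * x" "Y - X - 2 = 6 * y"
      by (elim dvdE)
    thus ?thesis
      by (intro that[of x y]) simp
  next
    case 3
    have "3 dvd Y" "6 dvd - X - Y - 2"
      using par 3 by (auto intro!: six_dvd) presburger+
    then obtain x y where "Y = 3 * x" "- X - Y - 2 = 6 * y"
      by (elim dvdE)
    thus ?thesis
      by (intro that[of x y]) simp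
  next
    case 4
    have "6 dvd Y - X" "3 dvd - Y - 1"
      using par 4 by (auto intro!: six_dvd) presburger+
    then obtain x y where "Y - X = 6 * x" "- Y - 1 = 3 * y"
      by (elim dvdE)
    thus ?thesis
      by (intro that[of x y]) simp
  next
    case 5
    have "6 dvd - X - Y" "6 dvd X - Y - 2"
      using par 5 by (auto intro!: six_dvd) presburger+
    then obtain x y where "- X - Y = 6 * x" "X - Y - 2 = 6 * y"
      by (elim dvdE)
    thus ?thesis
      by (intro that[of x y]) simp
  next
    case 6
    have "3 dvd - Y" "6 dvd X + Y - 2"
      using par 6 by (auto intro!: six_dvd) presburger+
    then obtain x y where "- Y = 3 * x" "X + Y - 2 = 6 * y"
      by (elim dvdE)
    thus ?thesis
      by (intro that[of x y]) simp
  qed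
qed

text \<open>The families differ by multiplication of \<open>X + Y\<surd>(-3)\<close> by sixth roots of unity, so they share one norm.\<close>

lemma norm_of_six_families:
  fixes x y X Y :: int
  assumes "(X, Y) \<in>
      {(6*x + 3*y + 1, 3*y + 1),
       (3*x - 3*y - 1, 3*x + 3*y + 1),
       (- 3*x - 6*y - 2, 3*x),
       (- 6*x - 3*y - 1, - 3*y - 1),
       (- 3*x + 3*y + 1, - 3*x - 3*y - 1),
       (3*x + 6*y + 2, - 3*x)}"
  shows "X\<^sup>2 + 3 * Y\<^sup>2 = 12 * (3 * x\<^sup>2 + 3 * x * y + 3 * y\<^sup>2 + x + 2 * y) + 4"
    (is "_ = ?N")
proof -
  have families:
    "(6*x + 3*y + 1)\<^sup>2 + 3 * (3*y + 1)\<^sup>2 = ?N"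
    "(3*x - 3*y - 1)\<^sup>2 + 3 * (3*x + 3*y + 1)\<^sup>2 = ?N"
    "(- 3*x - 6*y - 2)\<^sup>2 + 3 * (3*x)\<^sup>2 = ?N"
    "(- 6*x - 3*y - 1)\<^sup>2 + 3 * (- 3*y - 1)\<^sup>2 = ?N"
    "(- 3*x + 3*y + 1)\<^sup>2 + 3 * (- 3*x - 3*y - 1)\<^sup>2 = ?N"
    "(3*x + 6*y + 2)\<^sup>2 + 3 * (- 3*x)\<^sup>2 = ?N"
    by algebra+
  show ?thesis
    using assms by (elim insertE emptyE) (simp_all only: prod.inject families)
qed

theorem theorem3p2:
  fixes n :: nat
  shows "U_set (12 * n + 4) =
    (\<Union>(x, y) \<in> core_vectors n.
      {(6*x + 3*y + 1, 3*y + 1),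
       (3*x - 3*y - 1, 3*x + 3*y + 1),
       (- 3*x - 6*y - 2, 3*x),
       (- 6*x - 3*y - 1, - 3*y - 1),
       (- 3*x + 3*y + 1, - 3*x - 3*y - 1),
       (3*x + 6*y + 2, - 3*x)})"
    (is "_ = (\<Union>(x, y) \<in> _. ?F x y)")
proof (intro equalityI subsetI)
  fix v assume "v \<in> U_set (12 * n + 4)"
  then obtain X Y where v: "v = (X, Y)" and XY: "X\<^sup>2 + 3 * Y\<^sup>2 = 12 * int n + 4"
    by (auto simp: U_set_def)
  obtain x y where F: "(X, Y) \<in> ?F x y"
    using six_families_cover[OF congruences_of_representation[OF XY]] by blast
  have "(x, y) \<in> core_vectors n"
    using norm_of_six_families[OF F] XY by (simp add: core_vectors_eq)
  thus "v \<in> (\<Union>(x, y) \<in> core_vectors n. ?F x y)"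
    using F unfolding v by blast
next
  fix v assume "v \<in> (\<Union>(x, y) \<in> core_vectors n. ?F x y)"
  then obtain x y where xy: "(x, y) \<in> core_vectors n" and v: "v \<in> ?F x y"
    by blast
  obtain X Y where XY: "v = (X, Y)" by (cases v)
  have "X\<^sup>2 + 3 * Y\<^sup>2 = 12 * (3 * x\<^sup>2 + 3 * x * y + 3 * y\<^sup>2 + x + 2 * y) + 4"
    by (rule norm_of_six_families) (use v XY in blast)
  thus "v \<in> U_set (12 * n + 4)"
    using xy by (simp add: XY U_set_def core_vectors_eq)
qed

end
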